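(* Let $A=\langle\langle X\rangle\rangle$ be a PAJ generated by a set $X$ of primitive axes. (i) $A$ is spanned (as a vector space) by $\operatorname{Cl}(X)$. (ii) Let $V\subseteq A$ be a subspace containing $X$ such that for all $v\in V$ and $x\in X$ one has $xv\in V$ or $vx\in V$. Then $V=A$. (iii) If $X$ is uniform of type $\{\lambda,\delta\}$ (resp. $(\lambda,\delta)$, resp. $\lambda$), then $A$ is spanned by primitive axes of type $\{\lambda,\delta\}$ (resp. $(\lambda,\delta)$, resp. $\lambda$).
   Context: Algebras are not necessarily associative, commutative or unital. $\mathbb F$ is a field of characteristic $\ne 2$ and $A$ is an $\mathbb F$-algebra. $\langle\langle X\rangle\rangle$ is the subalgebra of $A$ generated by $X$. For an idempotent $a\in A$ put $A_0(a)=\{y\in A: ay=ya=0\}$ and $A_{\lambda,\delta}(a)=\{y\in A: ay=\lambda y,\ ya=\delta y\}$. For $\lambda,\delta\in\mathbb F\setminus\{0,1\}$, a primitive axis of type $(\lambda,\delta)$ is a nonzero idempotent $a\in A$ with $\{y:ay=y\}=\mathbb Fa=\{y:ya=y\}$, such that $A=\mathbb Fa\oplus A_0(a)\oplus A_{\lambda,\delta}(a)$ and this is a $\mathbb Z_2$-grading with even part $\mathbb Fa\oplus A_0(a)$ and odd part $A_{\lambda,\delta}(a)$. If $\lambda=\delta$ the type is called commutative and is also denoted $\lambda$; if $\lambda\neq\delta$ it is called noncommutative, and then $\lambda+\delta=1$ (a known fact, taken as a convention). Each primitive axis is regarded as carrying exactly one type (if $A_{\lambda,\delta}(a)=0$,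 a fixed choice is made). A PAJ is an algebra generated by a set of primitive axes (possibly of different types). The Miyamoto involution of a primitive axis $a$ of type $(\lambda,\delta)$ is the automorphism $\tau_a$ of $A$ that is the identity on $\mathbb Fa\oplus A_0(a)$ and $-1$ on $A_{\lambda,\delta}(a)$. $\mathcal G(X)$ is the group of automorphisms generated by $\{\tau_x:x\in X\}$, $x^\rho$ denotes $\rho(x)$, and $\operatorname{Cl}(X)=\{x^\rho: x\in X,\ \rho\in\mathcal G(X)\}$. $X$ is uniform of type $(\lambda,\delta)$ ($\lambda\ne\delta$) if all its elements have type $(\lambda,\delta)$; uniform of type $\lambda$ if all its elements have commutative type $\lambda$; uniform of type $\{\lambda,\delta\}$ if all its elements have type $(\lambda,\delta)$ or $(\delta,\lambda)$. "Primitive axes of type $\{\lambda,\delta\}$" means primitive axes of type $(\lambda,\delta)$ or $(\delta,\lambda)$. *)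

theory Defs
  imports Complex_Main "HOL-Algebra.Generated_Groups"
begin

text \<open>
  An algebra over a field, in which multiplication is only assumed to be bilinear. The algebra
  is the whole type \<open>'a\<close>.
\<close>

locale nonassoc_algebra = vector_space scale
  for scale :: "'f::field \<Rightarrow> 'a::ab_group_add \<Rightarrow> 'a" +
  fixes amult :: "'a \<Rightarrow> 'a \<Rightarrow> 'a"  (infixl \<open>\<bullet>\<close> 70)
  assumes amult_add_left: "(x + y) \<bullet> z = x \<bullet> z + y \<bullet> z"
    and amult_add_right: "x \<bullet> (y + z) = x \<bullet> y + x \<bullet> z"
    and amult_scale_left: "scale c x \<bullet> y = scale c (x \<bullet> y)"
    and amult_scale_right: "x \<bullet> scale c y = scale c (x \<bullet> y)"
begin

definition is_subalgebra :: "'a set \<Rightarrow> bool" where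
  "is_subalgebra S \<longleftrightarrow> subspace S \<and> (\<forall>x\<in>S. \<forall>y\<in>S. x \<bullet> y \<in> S)"

definition generated_subalgebra :: "'a set \<Rightarrow> 'a set" where
  "generated_subalgebra X = is_subalgebra hull X"

definition null_part :: "'a \<Rightarrow> 'a set" where
  "null_part a = {y. a \<bullet> y = 0 \<and> y \<bullet> a = 0}"

definition eigen_part :: "'f \<Rightarrow> 'f \<Rightarrow> 'a \<Rightarrow> 'a set" where
  "eigen_part \<mu> \<delta> a = {y. a \<bullet> y = scale \<mu> y \<and> y \<bullet> a = scale \<delta> y}"

definition even_part :: "'a \<Rightarrow> 'a set" where
  "even_part a = {u + v |u v. u \<in> span {a} \<and> v \<in> null_part a}"

definition Z2_grading :: "'a set \<Rightarrow> 'a set \<Rightarrow> bool" where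
  "Z2_grading E D \<longleftrightarrow>
     subspace E \<and> subspace D \<and>
     (\<forall>y. \<exists>!(u, v). u \<in> E \<and> v \<in> D \<and> y = u + v) \<and>
     (\<forall>x\<in>E. \<forall>y\<in>E. x \<bullet> y \<in> E) \<and>
     (\<forall>x\<in>E. \<forall>y\<in>D. x \<bullet> y \<in> D) \<and>
     (\<forall>x\<in>D. \<forall>y\<in>E. x \<bullet> y \<in> D) \<and>
     (\<forall>x\<in>D. \<forall>y\<in>D. x \<bullet> y \<in> E)"

text \<open>
  The last conjunct is a convention. In an algebra generated by primitive axes,
  \<open>\<mu> \<noteq> \<delta>\<close> is known to force \<open>\<mu> + \<delta> = 1\<close> unless the
  \<open>(\<mu>, \<delta>)\<close>-eigenspace of the axis is zero; in that case every pair in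
  \<open>F - {0, 1}\<close> would satisfy the remaining conditions on a primitive axis, and the
  convention restricts the choice of type.
\<close>

definition admissible_type :: "'f \<times> 'f \<Rightarrow> bool" where
  "admissible_type t \<longleftrightarrow>
     fst t \<notin> {0, 1} \<and> snd t \<notin> {0, 1} \<and> (fst t \<noteq> snd t \<longrightarrow> fst t + snd t = 1)"

definition primitive_axis_of_type :: "'f \<times> 'f \<Rightarrow> 'a \<Rightarrow> bool" where
  "primitive_axis_of_type t a \<longleftrightarrow>
     admissible_type t \<and>
     a \<noteq> 0 \<and> a \<bullet> a = a \<and>
     {y. a \<bullet> y = y} = span {a} \<and> {y. y \<bullet> a = y} = span {a} \<and>
     (\<forall>y. \<exists>!(u, v, w). u \<in> span {a} \<and> v \<in> null_part a \<and> w \<in> eigen_part (fst t) (snd t) a \<and>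
        y = u + v + w) \<and>
     Z2_grading (even_part a) (eigen_part (fst t) (snd t) a)"

definition primitive_axis :: "'a \<Rightarrow> bool" where
  "primitive_axis a \<longleftrightarrow> (\<exists>t. primitive_axis_of_type t a)"

definition PAJ_generated_by :: "'a set \<Rightarrow> bool" where
  "PAJ_generated_by X \<longleftrightarrow> (\<forall>x\<in>X. primitive_axis x) \<and> generated_subalgebra X = UNIV"

definition automorphism :: "('a \<Rightarrow> 'a) \<Rightarrow> bool" where
  "automorphism \<phi> \<longleftrightarrow>
     bij \<phi> \<and> Vector_Spaces.linear scale scale \<phi> \<and> (\<forall>x y. \<phi> (x \<bullet> y) = \<phi> x \<bullet> \<phi> y)"

definition automorphism_group :: "('a \<Rightarrow> 'a) monoid" where
  "automorphism_group = \<lparr>carrier = {\<phi>. automorphism \<phi>}, monoid.mult = (\<circ>), one = id\<rparr>"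

end

text \<open>
  A fixed choice \<open>axis_type\<close> of exactly one type for each primitive axis. There is a real
  choice only for the axes whose odd part is zero.
\<close>

locale typed_algebra = nonassoc_algebra scale amult
  for scale :: "'f::field \<Rightarrow> 'a::ab_group_add \<Rightarrow> 'a"
    and amult :: "'a \<Rightarrow> 'a \<Rightarrow> 'a"  (infixl \<open>\<bullet>\<close> 70) +
  fixes axis_type :: "'a \<Rightarrow> 'f \<times> 'f"
  assumes axis_type: "primitive_axis a \<Longrightarrow> primitive_axis_of_type (axis_type a) a"
begin

definition odd_part :: "'a \<Rightarrow> 'a set" where
  "odd_part a = eigen_part (fst (axis_type a)) (snd (axis_type a)) a"

definition miyamoto :: "'a \<Rightarrow> 'a \<Rightarrow> 'a" where
  "miyamoto a = (THE \<phi>. automorphism \<phi> \<and> (\<forall>y\<in>even_part a. \<phi> y = y) \<and> (\<forall>y\<in>odd_part a. \<phi> y = - y))"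

definition miyamoto_group :: "'a set \<Rightarrow> ('a \<Rightarrow> 'a) set" where
  "miyamoto_group X = generate automorphism_group (miyamoto ` X)"

definition Cl :: "'a set \<Rightarrow> 'a set" where
  "Cl X = {\<rho> x |x \<rho>. x \<in> X \<and> \<rho> \<in> miyamoto_group X}"

definition primitive_axes :: "('f \<times> 'f) set \<Rightarrow> 'a set" where
  "primitive_axes T = {a. primitive_axis a \<and> axis_type a \<in> T}"

definition uniform :: "('f \<times> 'f) set \<Rightarrow> 'a set \<Rightarrow> bool" where
  "uniform T X \<longleftrightarrow> X \<subseteq> primitive_axes T"

end

text \<open>The automorphisms form a group, and the description of the Miyamoto involution is proper.\<close>

lemma (in nonassoc_algebra) group_automorphism_group: "group automorphism_group"
proof (rule groupI)
  fix x y assume "x \<in> carrier automorphism_group" "y \<in> carrier automorphism_group"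
  then show "x \<otimes>\<^bsub>automorphism_group\<^esub> y \<in> carrier automorphism_group"
    by (auto simp: automorphism_group_def automorphism_def bij_comp
        intro: Vector_Spaces.linear_compose)
next
  show "\<one>\<^bsub>automorphism_group\<^esub> \<in> carrier automorphism_group"
    by (auto simp: automorphism_group_def automorphism_def linear_id)
next
  fix x assume "x \<in> carrier automorphism_group"
  then have b: "bij x" and l: "Vector_Spaces.linear scale scale x"
    and m: "\<And>u v. x (u \<bullet> v) = x u \<bullet> x v"
    by (auto simp: automorphism_group_def automorphism_def)
  interpret l: Vector_Spaces.linear scale scale x by (rule l)
  have inv: "inv_into UNIV x (x u) = u" "x (inv_into UNIV x u) = u" for u
    using b by (simp_all add: bij_is_inj bij_is_surj surj_f_inv_f)
  have "automorphism (inv_into UNIV x)"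
    unfolding automorphism_def
  proof (intro conjI allI)
    show "bij (inv_into UNIV x)" using b by (rule bij_imp_bij_inv)
    have "inv_into UNIV x (u + v) = inv_into UNIV x u + inv_into UNIV x v" for u v
      by (metis inv l.add)
    moreover have "inv_into UNIV x (scale c u) = scale c (inv_into UNIV x u)" for c u
      by (metis inv l.scale)
    ultimately show "Vector_Spaces.linear scale scale (inv_into UNIV x)"
      by unfold_locales auto
    show "inv_into UNIV x (u \<bullet> v) = inv_into UNIV x u \<bullet> inv_into UNIV x v" for u v
      by (metis inv m)
  qed
  then show "\<exists>y\<in>carrier automorphism_group. y \<otimes>\<^bsub>automorphism_group\<^esub> x = \<one>\<^bsub>automorphism_group\<^esub>"
    by (intro bexI[of _ "inv_into UNIV x"]) (auto simp: automorphism_group_def inv)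
qed (auto simp: automorphism_group_def)

lemma (in typed_algebra) miyamoto_unique_ex:
  assumes "primitive_axis a"
  shows "\<exists>!\<phi>. automorphism \<phi> \<and> (\<forall>y\<in>even_part a. \<phi> y = y) \<and> (\<forall>y\<in>odd_part a. \<phi> y = - y)"
proof -
  define E where "E = even_part a"
  define D where "D = odd_part a"
  have "Z2_grading E D"
    using axis_type[OF assms] by (simp add: primitive_axis_of_type_def E_def D_def odd_part_def)
  then have sE: "subspace E" and sD: "subspace D"
    and ex: "\<And>y. \<exists>!(u, v). u \<in> E \<and> v \<in> D \<and> y = u + v"
    and EE: "\<And>x y. x \<in> E \<Longrightarrow> y \<in> E \<Longrightarrow> x \<bullet> y \<in> E"
    and ED: "\<And>x y. x \<in> E \<Longrightarrow> y \<in> D \<Longrightarrow> x \<bullet> y \<in> D"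
    and DE: "\<And>x y. x \<in> D \<Longrightarrow> y \<in> E \<Longrightarrow> x \<bullet> y \<in> D"
    and DD: "\<And>x y. x \<in> D \<Longrightarrow> y \<in> D \<Longrightarrow> x \<bullet> y \<in> E"
    by (auto simp: Z2_grading_def)
  have "\<exists>p. fst p \<in> E \<and> snd p \<in> D \<and> y = fst p + snd p" for y
    using ex1_implies_ex[OF ex[of y]] by (elim exE) (simp add: case_prod_beta, blast)
  then obtain p where p: "\<And>y. fst (p y) \<in> E" "\<And>y. snd (p y) \<in> D" "\<And>y. y = fst (p y) + snd (p y)"
    by metis
  define e where "e y = fst (p y)" for y
  define d where "d y = snd (p y)" for y
  have eE: "e y \<in> E" and dD: "d y \<in> D" and y: "e y + d y = y" for y
    using p[of y] by (auto simp: e_def d_def)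
  have uniq: "e (u + v) = u \<and> d (u + v) = v" if "u \<in> E" "v \<in> D" for u v
  proof -
    obtain q where q: "\<And>r. (case r of (a, b) \<Rightarrow> a \<in> E \<and> b \<in> D \<and> u + v = a + b) \<Longrightarrow> r = q"
      using ex[of "u + v"] by (elim ex1E) blast
    have "(e (u + v), d (u + v)) = q" by (rule q) (simp add: eE dD y)
    moreover have "(u, v) = q" by (rule q) (simp add: that)
    ultimately show ?thesis by (metis prod.inject)
  qed
  define \<phi> where "\<phi> y = e y - d y" for y
  have \<phi>: "\<phi> (u + v) = u - v" if "u \<in> E" "v \<in> D" for u v
    using uniq[OF that] by (simp add: \<phi>_def)
  have add: "\<phi> (x + y) = \<phi> x + \<phi> y" for x y
  proof -
    have "x + y = (e x + e y) + (d x + d y)" using arg_cong2[OF y[of x, symmetric] y[of y, symmetric], of "(+)"] by (simp only: add_ac)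
    then show ?thesis
      using \<phi>[of "e x + e y" "d x + d y"] sE sD eE dD by (simp add: subspace_add) (simp add: \<phi>_def)
  qed
  have scale: "\<phi> (scale c x) = scale c (\<phi> x)" for c x
  proof -
    have "scale c x = scale c (e x) + scale c (d x)" using y[of x] by (metis scale_right_distrib)
    then show ?thesis
      using \<phi>[of "scale c (e x)" "scale c (d x)"] sE sD eE dD
      by (simp add: subspace_scale) (simp add: \<phi>_def scale_right_diff_distrib)
  qed
  have mneg: "x \<bullet> (- y) = - (x \<bullet> y)" "(- x) \<bullet> y = - (x \<bullet> y)" for x y
    using amult_scale_right[of x "-1" y] amult_scale_left[of "-1" x y] by simp_all
  have mult: "\<phi> (x \<bullet> y) = \<phi> x \<bullet> \<phi> y" for x y
  proof -
    have "x \<bullet> y = (e x + d x) \<bullet> (e y + d y)" by (simp add: y)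
    also have "\<dots> = (e x \<bullet> e y + d x \<bullet> d y) + (e x \<bullet> d y + d x \<bullet> e y)"
      by (simp add: amult_add_left amult_add_right)
    finally have "\<phi> (x \<bullet> y) = (e x \<bullet> e y + d x \<bullet> d y) - (e x \<bullet> d y + d x \<bullet> e y)"
      using \<phi> EE ED DE DD eE dD sE sD by (simp add: subspace_add)
    also have "\<dots> = (e x + - d x) \<bullet> (e y + - d y)"
      unfolding amult_add_left amult_add_right mneg by simp
    finally show ?thesis by (simp add: \<phi>_def)
  qed
  have inv: "\<phi> (\<phi> x) = x" for x
    using \<phi>[OF eE subspace_neg[OF sD dD], of x x] y[of x] by (simp add: \<phi>_def)
  have aut: "automorphism \<phi>"
    unfolding automorphism_def
  proof (intro conjI allI)
    show "bij \<phi>" by (rule o_bij[of \<phi>]) (auto simp: inv)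
    show "Vector_Spaces.linear scale scale \<phi>" using add scale by unfold_locales auto
  qed (rule mult)
  show ?thesis
    unfolding E_def[symmetric] D_def[symmetric]
  proof (rule ex1I[of _ \<phi>], intro conjI ballI)
    show "\<phi> y = y" if "y \<in> E" for y using \<phi>[OF that subspace_0[OF sD]] by simp
    show "\<phi> y = - y" if "y \<in> D" for y using \<phi>[OF subspace_0[OF sE] that] by simp
    fix \<psi> assume \<psi>: "automorphism \<psi> \<and> (\<forall>y\<in>E. \<psi> y = y) \<and> (\<forall>y\<in>D. \<psi> y = - y)"
    then interpret \<psi>: Vector_Spaces.linear scale scale \<psi> by (simp add: automorphism_def)
    show "\<psi> = \<phi>"
    proof
      fix x
      show "\<psi> x = \<phi> x"
        using \<psi>.add[of "e x" "d x"] \<psi> eE dD y[of x] by (simp add: \<phi>_def)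
    qed
  qed (rule aut)
qed

end

theory Submission
  imports Defs
begin

text \<open>
  For \<open>v = c x + v\<^sub>0 + v\<^sub>1\<close> with \<open>v\<^sub>0\<close> in the null part and \<open>v\<^sub>1\<close> in the odd part
  of an axis \<open>x\<close>, each of \<open>x v\<close>, \<open>v x\<close> and \<open>\<tau>\<^sub>x(v) = v - 2 v\<^sub>1\<close> determines \<open>v\<^sub>1\<close> up to
  multiples of \<open>x\<close>. Hence a subspace containing \<open>x\<close> is closed under multiplication by \<open>x\<close>, on
  either side, if and only if it is \<open>\<tau>\<^sub>x\<close>-invariant. So the span of \<open>Cl X\<close> is closed under
  multiplication by \<open>X\<close>, and by conjugation under multiplication by \<open>Cl X\<close>; thus it is a
  subalgebra. A subspace as in (ii) is invariant under \<open>\<G>(X)\<close> and therefore contains \<open>Cl X\<close>.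
  Finally, an axis with nonzero odd part has only one possible type, which automorphisms
  preserve, while an axis with zero odd part is fixed by every Miyamoto involution, so that the
  choice of its type does no harm.
\<close>

text \<open>Serves to carry unique decompositions along an automorphism, with \<open>f\<close> its
  componentwise action on pairs or triples.\<close>

lemma Ex1_bij:
  assumes "bij f" and "\<exists>!x. P (f x)"
  shows "\<exists>!x. P x"
  using assms by (metis bij_pointE)

section \<open>Decompositions and types relative to a single axis\<close>

context nonassoc_algebra
begin

lemma amult_zero [simp]: "0 \<bullet> y = 0" "x \<bullet> 0 = 0"
  using amult_scale_left[of 0 0 y] amult_scale_right[of x 0 0] by simp_all

lemma axis_decomp:
  assumes "primitive_axis_of_type t a"
  obtains c v w where "y = scale c a + v + w" "v \<in> null_part a" "w \<in> eigen_part (fst t) (snd t) a"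
proof -
  have "\<exists>!(u, v, w). u \<in> span {a} \<and> v \<in> null_part a \<and> w \<in> eigen_part (fst t) (snd t) a \<and> y = u + v + w"
    using assms by (simp add: primitive_axis_of_type_def)
  then obtain u v w where "u \<in> span {a}" "v \<in> null_part a" "w \<in> eigen_part (fst t) (snd t) a" "y = u + v + w"
    by blast
  then show thesis using that by (auto simp: span_singleton)
qed

text \<open>Since \<open>a\<close> is nonzero, the component in \<open>span {a}\<close> determines
  its coefficient as well. Equations between elements can then be compared component by
  component.\<close>

lemma axis_decomp_unique:
  assumes t: "primitive_axis_of_type t a"
    and v: "v \<in> null_part a" "v' \<in> null_part a"
    and w: "w \<in> eigen_part (fst t) (snd t) a" "w' \<in> eigen_part (fst t) (snd t) a"
    and eq: "scale c a + v + w = scale c' a + v' + w'"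
  shows "c = c' \<and> v = v' \<and> w = w'"
proof -
  have "\<exists>!p. (\<lambda>(u, v', w'). u \<in> span {a} \<and> v' \<in> null_part a \<and> w' \<in> eigen_part (fst t) (snd t) a \<and>
    scale c a + v + w = u + v' + w') p"
    using t by (simp add: primitive_axis_of_type_def)
  moreover have "scale d a \<in> span {a}" for d
    by (simp add: span_base span_scale)
  ultimately have "(scale c a, v, w) = (scale c' a, v', w')"
    using v w eq by (elim ex1E) (smt (verit, del_insts) case_prod_conv)
  moreover have "a \<noteq> 0"
    using t by (simp add: primitive_axis_of_type_def)
  ultimately show ?thesis by simp
qed

lemma null_part_zero: "0 \<in> null_part a"
  by (simp add: null_part_def)

lemma null_part_scale: "v \<in> null_part a \<Longrightarrow> scale c v \<in> null_part a"
  by (simp add: null_part_def amult_scale_left amult_scale_right)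

lemma eigen_part_zero: "0 \<in> eigen_part \<mu> \<delta> a"
  by (simp add: eigen_part_def)

lemma eigen_part_scale: "w \<in> eigen_part \<mu> \<delta> a \<Longrightarrow> scale c w \<in> eigen_part \<mu> \<delta> a"
  by (simp add: eigen_part_def amult_scale_left amult_scale_right mult.commute)

lemma axis_mult:
  assumes "a \<bullet> a = a" "v \<in> null_part a" "w \<in> eigen_part \<mu> \<delta> a"
  shows "a \<bullet> (scale c a + v + w) = scale c a + scale \<mu> w"
    and "(scale c a + v + w) \<bullet> a = scale c a + scale \<delta> w"
  using assms
  by (simp_all add: amult_add_left amult_add_right amult_scale_left amult_scale_right
      null_part_def eigen_part_def)

text \<open>Split \<open>w\<close> along the decomposition belonging to \<open>s\<close>. Left
  multiplication by \<open>a\<close> has eigenvalues 1, 0 and \<open>fst s\<close> on the three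
  summands, but acts on \<open>w\<close> as \<open>fst t\<close>, which is neither 0 nor 1. Only the
  last component survives, so \<open>w\<close> lies in both eigenspaces and, being nonzero, forces
  both pairs of eigenvalues to agree.\<close>

lemma axis_type_unique:
  assumes t: "primitive_axis_of_type t a" and s: "primitive_axis_of_type s a"
    and w: "w \<in> eigen_part (fst t) (snd t) a" "w \<noteq> 0"
  shows "s = t"
proof -
  have a: "a \<bullet> a = a" and ft: "fst t \<noteq> 0" "fst t \<noteq> 1"
    using t by (auto simp: primitive_axis_of_type_def admissible_type_def)
  obtain c v w' where eq: "w = scale c a + v + w'"
    and v: "v \<in> null_part a" and w': "w' \<in> eigen_part (fst s) (snd s) a"
    by (rule axis_decomp[OF s])
  have "scale c a + 0 + scale (fst s) w'
    = scale (fst t * c) a + scale (fst t) v + scale (fst t) w'"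
    using axis_mult(1)[OF a v w', of c] w(1) eq
    by (simp add: eigen_part_def scale_right_distrib)
  then have "c = fst t * c" "0 = scale (fst t) v" "scale (fst s) w' = scale (fst t) w'"
    using axis_decomp_unique[OF s null_part_zero null_part_scale[OF v] eigen_part_scale[OF w'] eigen_part_scale[OF w']]
    by blast+
  then have "w' = w" "fst s = fst t"
    using ft eq w(2) by auto
  moreover from this have "snd s = snd t"
    using w w' by (auto simp: eigen_part_def)
  ultimately show ?thesis by (simp add: prod_eq_iff)
qed

text \<open>
  Since \<open>x\<close> has no odd part, \<open>y x\<close> is a multiple \<open>\<alpha> x\<close>. If \<open>x\<close> had a nonzero component in the
  odd part of \<open>y\<close>, then \<open>\<alpha>\<close> would be the eigenvalue there, so that \<open>x = x x\<close> would be both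
  odd and even.
\<close>

lemma axis_without_odd_part_even:
  assumes x: "primitive_axis_of_type t x" and odd: "eigen_part (fst t) (snd t) x \<subseteq> {0}"
    and y: "primitive_axis_of_type s y"
  shows "x \<in> even_part y"
proof -
  have xx: "x \<bullet> x = x" "x \<noteq> 0"
    using x by (auto simp: primitive_axis_of_type_def)
  have yy: "y \<bullet> y = y" and fs: "fst s \<noteq> 0" "fst s \<noteq> 1"
    and grading: "Z2_grading (even_part y) (eigen_part (fst s) (snd s) y)"
    using y by (auto simp: primitive_axis_of_type_def admissible_type_def)
  obtain \<alpha> u where "y = scale \<alpha> x + u" "u \<in> null_part x"
    using axis_decomp[OF x, of y] odd by (metis add.right_neutral singletonD subsetD)
  then have yx: "y \<bullet> x = scale \<alpha> x"
    by (simp add: amult_add_left amult_scale_left null_part_def xx)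
  obtain \<beta> n w where eq: "x = scale \<beta> y + n + w"
    and n: "n \<in> null_part y" and w: "w \<in> eigen_part (fst s) (snd s) y"
    by (rule axis_decomp[OF y])
  have "scale \<beta> y + 0 + scale (fst s) w = scale (\<alpha> * \<beta>) y + scale \<alpha> n + scale \<alpha> w"
    using axis_mult(1)[OF yy n w, of \<beta>] yx eq by (simp add: scale_right_distrib)
  then have co: "\<beta> = \<alpha> * \<beta>" "0 = scale \<alpha> n" "scale (fst s) w = scale \<alpha> w"
    using axis_decomp_unique[OF y null_part_zero null_part_scale[OF n] eigen_part_scale[OF w] eigen_part_scale[OF w]]
    by blast+
  have "w = 0"
  proof (rule ccontr)
    assume "w \<noteq> 0"
    \<comment> \<open>Cancelling \<open>w\<close> in \<open>co\<close> gives
      \<open>\<alpha> = fst s\<close>, which is neither 1 nor 0; hence \<open>\<beta> = 0\<close>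
      and \<open>n = 0\<close>.\<close>
    with co fs eq have "x = w" by auto
    with w grading xx(1) have "x \<in> even_part y"
      unfolding Z2_grading_def by metis
    then obtain c v where "x = scale c y + v" "v \<in> null_part y"
      by (auto simp: even_part_def span_singleton)
    then have "scale c y + v + 0 = scale 0 y + 0 + w"
      using \<open>x = w\<close> by simp
    then have "w = 0"
      using axis_decomp_unique[OF y \<open>v \<in> null_part y\<close> null_part_zero eigen_part_zero w] by blast
    with \<open>w \<noteq> 0\<close> show False by contradiction
  qed
  with eq n show ?thesis
    by (auto simp: even_part_def span_singleton)
qed

section \<open>Transport of axes along automorphisms\<close>

text \<open>Every condition on an axis is phrased through the algebra structure, which a bijective
  homomorphism both preserves and reflects.\<close>

lemma automorphism_axis_of_type:
  assumes aut: "automorphism \<phi>" and a: "primitive_axis_of_type t a"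
  shows "primitive_axis_of_type t (\<phi> a)"
proof -
  interpret l: Vector_Spaces.linear scale scale \<phi>
    using aut by (simp add: automorphism_def)
  have bij: "bij \<phi>" and mult: "\<phi> x \<bullet> \<phi> y = \<phi> (x \<bullet> y)" for x y
    using aut by (auto simp: automorphism_def)
  have inj: "\<phi> x = \<phi> y \<longleftrightarrow> x = y" for x y
    using bij by (meson bij_is_inj inj_eq)
  \<comment> \<open>By bijectivity each bound variable can be written as an image under
    \<open>\<phi>\<close>; the equivalences collected below then strip \<open>\<phi>\<close> from
    the conditions.\<close>
  have surj: "(\<forall>x. P x) \<longleftrightarrow> (\<forall>x. P (\<phi> x))" for P
    using bij by (metis bij_pointE)
  have ex: "(\<exists>x. P x) \<longleftrightarrow> (\<exists>x. P (\<phi> x))" for P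
    using bij by (metis bij_pointE)
  have zero: "\<phi> x = 0 \<longleftrightarrow> x = 0" for x
    using inj[of x 0] by (simp add: l.zero)
  note img = mult inj zero l.scale[symmetric] l.add[symmetric]
  have span: "\<phi> y \<in> span {\<phi> a} \<longleftrightarrow> y \<in> span {a}" for y
    by (auto simp: span_singleton image_iff img)
  have null: "\<phi> y \<in> null_part (\<phi> a) \<longleftrightarrow> y \<in> null_part a" for y
    by (simp add: null_part_def img)
  have eigen: "\<phi> y \<in> eigen_part \<mu> \<delta> (\<phi> a) \<longleftrightarrow> y \<in> eigen_part \<mu> \<delta> a" for y \<mu> \<delta>
    by (simp add: eigen_part_def img)
  have even: "\<phi> y \<in> even_part (\<phi> a) \<longleftrightarrow> y \<in> even_part a" for y
    unfolding even_part_def mem_Collect_eq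
    by (subst ex, subst (2) ex) (simp add: span null img)
  have even_image: "even_part (\<phi> a) = \<phi> ` even_part a"
    and eigen_image: "eigen_part \<mu> \<delta> (\<phi> a) = \<phi> ` eigen_part \<mu> \<delta> a" for \<mu> \<delta>
    using even eigen bij by (auto simp: image_iff) (metis bij_pointE)+
  have adm: "admissible_type t" "\<phi> a \<noteq> 0" "\<phi> a \<bullet> \<phi> a = \<phi> a"
    using a by (simp_all add: primitive_axis_of_type_def img)
  have "{y. a \<bullet> y = y} = span {a}" "{y. y \<bullet> a = y} = span {a}"
    using a by (simp_all add: primitive_axis_of_type_def)
  then have eig1: "{y. \<phi> a \<bullet> y = y} = span {\<phi> a}" "{y. y \<bullet> \<phi> a = y} = span {\<phi> a}"
    unfolding set_eq_iff mem_Collect_eq by (subst surj, simp add: span img)+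
  have decomp: "\<forall>y. \<exists>!p. case p of (u, v, w) \<Rightarrow> u \<in> span {\<phi> a} \<and> v \<in> null_part (\<phi> a) \<and>
      w \<in> eigen_part (fst t) (snd t) (\<phi> a) \<and> y = u + v + w"
    by (subst surj, rule allI, rule Ex1_bij[of "map_prod \<phi> (map_prod \<phi> \<phi>)"])
      (use a in \<open>simp_all add: bij_betw_def prod.inj_map map_prod_surj bij_is_inj[OF bij]
        bij_is_surj[OF bij] case_prod_unfold span null eigen img primitive_axis_of_type_def\<close>)
  have grading: "Z2_grading (even_part a) (eigen_part (fst t) (snd t) a)"
    using a by (simp add: primitive_axis_of_type_def)
  have decomp2: "\<forall>y. \<exists>!p. case p of (u, v) \<Rightarrow> u \<in> even_part (\<phi> a) \<and>
      v \<in> eigen_part (fst t) (snd t) (\<phi> a) \<and> y = u + v"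
    by (subst surj, rule allI, rule Ex1_bij[of "map_prod \<phi> \<phi>"])
      (use grading in \<open>simp_all add: bij_betw_def prod.inj_map map_prod_surj bij_is_inj[OF bij]
        bij_is_surj[OF bij] case_prod_unfold even eigen img Z2_grading_def\<close>)
  have "Z2_grading (even_part (\<phi> a)) (eigen_part (fst t) (snd t) (\<phi> a))"
    unfolding Z2_grading_def
  proof (intro conjI)
    show "subspace (even_part (\<phi> a))" "subspace (eigen_part (fst t) (snd t) (\<phi> a))"
      using grading by (simp_all add: even_image eigen_image Z2_grading_def l.subspace_image)
  qed (use decomp2 grading in
      \<open>simp_all add: even_image eigen_image Z2_grading_def mult inj_image_mem_iff[OF bij_is_inj[OF bij]]\<close>)
  with adm eig1 decomp show ?thesis
    unfolding primitive_axis_of_type_def by blast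
qed

end

section \<open>Miyamoto involutions and the group they generate\<close>

context typed_algebra
begin

lemma miyamoto:
  assumes "primitive_axis a"
  shows "automorphism (miyamoto a)"
    and "y \<in> even_part a \<Longrightarrow> miyamoto a y = y"
    and "y \<in> odd_part a \<Longrightarrow> miyamoto a y = - y"
  using theI'[OF miyamoto_unique_ex[OF assms]] by (auto simp: miyamoto_def)

lemma miyamoto_decomp:
  assumes a: "primitive_axis a" and v: "v \<in> null_part a" and w: "w \<in> odd_part a"
  shows "miyamoto a (scale c a + v + w) = scale c a + v - w"
proof -
  interpret l: Vector_Spaces.linear scale scale "miyamoto a"
    using miyamoto(1)[OF a] by (simp add: automorphism_def)
  have "scale c a + v \<in> even_part a"
    using v by (auto simp: even_part_def span_singleton)
  then show ?thesis
    using miyamoto(2)[OF a, of "scale c a + v"] miyamoto(3)[OF a w] l.add[of "scale c a + v" w] by simp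
qed

lemma odd_decomp:
  assumes "primitive_axis a"
  obtains c v w where "y = scale c a + v + w" "v \<in> null_part a" "w \<in> odd_part a"
  using axis_decomp[OF axis_type[OF assms]] unfolding odd_part_def by metis

lemma odd_part_uminus: "w \<in> odd_part a \<Longrightarrow> - w \<in> odd_part a"
  using eigen_part_scale[of w _ _ a "-1"] by (simp add: odd_part_def)

lemma miyamoto_involution:
  assumes "primitive_axis a"
  shows "miyamoto a (miyamoto a y) = y"
proof -
  obtain c v w where y: "y = scale c a + v + w" "v \<in> null_part a" "w \<in> odd_part a"
    by (rule odd_decomp[OF assms])
  then show ?thesis
    using miyamoto_decomp[OF assms y(2,3), of c]
      miyamoto_decomp[OF assms y(2) odd_part_uminus[OF y(3)], of c] by simp
qed

lemma miyamoto_group_one: "id \<in> miyamoto_group X"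
  using generate.one[of automorphism_group "miyamoto ` X"]
  by (simp add: miyamoto_group_def automorphism_group_def)

lemma miyamoto_group_incl: "x \<in> X \<Longrightarrow> miyamoto x \<in> miyamoto_group X"
  by (simp add: miyamoto_group_def generate.incl)

lemma miyamoto_group_comp:
  "\<rho> \<in> miyamoto_group X \<Longrightarrow> \<sigma> \<in> miyamoto_group X \<Longrightarrow> \<rho> \<circ> \<sigma> \<in> miyamoto_group X"
  using generate.eng[of \<rho> automorphism_group "miyamoto ` X" \<sigma>]
  by (simp add: miyamoto_group_def automorphism_group_def)

lemma inv_miyamoto:
  assumes "primitive_axis a"
  shows "inv\<^bsub>automorphism_group\<^esub> (miyamoto a) = miyamoto a"
proof -
  interpret group automorphism_group by (rule group_automorphism_group)
  show ?thesis
    by (rule inv_equality)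
      (simp_all add: automorphism_group_def miyamoto[OF assms] fun_eq_iff miyamoto_involution[OF assms])
qed

text \<open>Each generator is its own inverse, so the inverse case of \<open>generate\<close>
  collapses into the generator case.\<close>

lemma miyamoto_group_induct [consumes 2, case_names id involution comp]:
  assumes "\<forall>x\<in>X. primitive_axis x" and "\<rho> \<in> miyamoto_group X"
    and "P id" and "\<And>x. x \<in> X \<Longrightarrow> P (miyamoto x)"
    and "\<And>\<rho> \<sigma>. P \<rho> \<Longrightarrow> P \<sigma> \<Longrightarrow> P (\<rho> \<circ> \<sigma>)"
  shows "P \<rho>"
  using assms(2) unfolding miyamoto_group_def
proof (induction rule: generate.induct)
  case one
  then show ?case using assms(3) by (simp add: automorphism_group_def id_def)
next
  case (incl h)
  then show ?case using assms(4) by auto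
next
  case (inv h)
  then show ?case using assms(1,4) inv_miyamoto by auto
next
  case (eng h1 h2)
  then show ?case using assms(5) by (simp add: automorphism_group_def comp_def)
qed

lemma miyamoto_group_automorphism:
  assumes "\<forall>x\<in>X. primitive_axis x" and "\<rho> \<in> miyamoto_group X"
  shows "automorphism \<rho>"
  using assms
proof (induction rule: miyamoto_group_induct)
  case id
  show ?case unfolding automorphism_def using linear_id by (simp only: bij_id id_apply simp_thms)
next
  case (involution x)
  then show ?case using assms(1) miyamoto(1) by blast
next
  case (comp \<rho> \<sigma>)
  then have "bij (\<rho> \<circ> \<sigma>)" "Vector_Spaces.linear scale scale (\<rho> \<circ> \<sigma>)"
    unfolding automorphism_def by (blast intro: bij_comp Vector_Spaces.linear_compose)+
  with comp show ?case by (simp add: automorphism_def comp_def)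
qed

text \<open>Invariance passes from generators to products. \<open>V\<close> ranges over arbitrary
  sets, so that the singleton of a fixed axis is covered too.\<close>

lemma miyamoto_group_subspace_invariant:
  assumes "\<forall>x\<in>X. primitive_axis x" and "\<rho> \<in> miyamoto_group X"
    and "\<And>x v. x \<in> X \<Longrightarrow> v \<in> V \<Longrightarrow> miyamoto x v \<in> V" and "v \<in> V"
  shows "\<rho> v \<in> V"
proof -
  have "\<forall>v\<in>V. \<rho> v \<in> V"
    using assms(1,2) by (induction rule: miyamoto_group_induct) (use assms(3) in auto)
  with assms(4) show ?thesis by blast
qed

text \<open>Supplies the element that pulls a product with \<open>\<rho> x\<close> back to a product
  with \<open>x\<close>.\<close>

lemma miyamoto_group_inverse:
  assumes "\<forall>x\<in>X. primitive_axis x" and "\<rho> \<in> miyamoto_group X"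
  obtains \<sigma> where "\<sigma> \<in> miyamoto_group X" "\<And>y. \<rho> (\<sigma> y) = y"
proof -
  have "\<exists>\<sigma>\<in>miyamoto_group X. \<forall>y. \<rho> (\<sigma> y) = y"
    using assms
  proof (induction rule: miyamoto_group_induct)
    case id
    show ?case using miyamoto_group_one by (intro bexI[of _ id]) simp_all
  next
    case (involution x)
    then show ?case using assms(1) miyamoto_involution miyamoto_group_incl by blast
  next
    case (comp \<rho> \<sigma>)
    then obtain \<rho>' \<sigma>' where "\<rho>' \<in> miyamoto_group X" "\<forall>y. \<rho> (\<rho>' y) = y"
      "\<sigma>' \<in> miyamoto_group X" "\<forall>y. \<sigma> (\<sigma>' y) = y" by blast
    then show ?case using miyamoto_group_comp by (intro bexI[of _ "\<sigma>' \<circ> \<rho>'"]) auto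
  qed
  with that show thesis by blast
qed

section \<open>Multiplication by an axis versus its involution\<close>

text \<open>Both eigenvalues on the odd part are nonzero, so a product on either side suffices to
  recover the odd component \<open>w\<close> of \<open>v\<close> modulo \<open>x\<close>.\<close>

lemma miyamoto_mem_if_mult_mem:
  assumes V: "subspace V" "x \<in> V" "v \<in> V" and x: "primitive_axis x"
    and mem: "x \<bullet> v \<in> V \<or> v \<bullet> x \<in> V"
  shows "miyamoto x v \<in> V"
proof -
  have xx: "x \<bullet> x = x" and adm: "fst (axis_type x) \<noteq> 0" "snd (axis_type x) \<noteq> 0"
    using axis_type[OF x] by (auto simp: primitive_axis_of_type_def admissible_type_def)
  obtain c n w where v: "v = scale c x + n + w" "n \<in> null_part x" "w \<in> odd_part x"
    by (rule odd_decomp[OF x])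
  note mult = axis_mult[OF xx v(2) v(3)[unfolded odd_part_def], of c, folded v(1)]
  \<comment> \<open>\<open>d\<close> is the left or the right eigenvalue, according to which product
    lies in \<open>V\<close>.\<close>
  obtain d where "d \<noteq> 0" "scale c x + scale d w \<in> V"
    using mem mult adm by metis
  then have "scale d w \<in> V"
    using subspace_diff[OF V(1) _ subspace_scale[OF V(1,2), of c]] by fastforce
  then have "w \<in> V"
    using subspace_scale[OF V(1), of "scale d w" "inverse d"] \<open>d \<noteq> 0\<close> by simp
  moreover have "miyamoto x v = v - w - w"
    using miyamoto_decomp[OF x v(2,3), of c] v(1) by simp
  ultimately show ?thesis using V by (simp add: subspace_diff)
qed

text \<open>Invariance yields only twice the odd component; \<open>two\<close> allows the division.
  Both products are combinations of \<open>x\<close> and that component.\<close>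

lemma mult_mem_if_miyamoto_mem:
  assumes two: "(2::'f) \<noteq> 0" and V: "subspace V" "x \<in> V" "v \<in> V" and x: "primitive_axis x"
    and mem: "miyamoto x v \<in> V"
  shows "x \<bullet> v \<in> V" and "v \<bullet> x \<in> V"
proof -
  have xx: "x \<bullet> x = x"
    using axis_type[OF x] by (auto simp: primitive_axis_of_type_def)
  obtain c n w where v: "v = scale c x + n + w" "n \<in> null_part x" "w \<in> odd_part x"
    by (rule odd_decomp[OF x])
  note mult = axis_mult[OF xx v(2) v(3)[unfolded odd_part_def], of c, folded v(1)]
  have "v - miyamoto x v = scale (1 + 1) w"
    using miyamoto_decomp[OF x v(2,3), of c] v(1) by (simp only: scale_left_distrib) simp
  then have "scale 2 w \<in> V"
    using subspace_diff[OF V(1,3) mem] by simp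
  then have "w \<in> V"
    using subspace_scale[OF V(1), of "scale 2 w" "inverse 2"] two by simp
  then show "x \<bullet> v \<in> V" "v \<bullet> x \<in> V"
    using V mult by (simp_all add: subspace_add subspace_scale)
qed

section \<open>The span of \<open>Cl X\<close> and invariant subspaces\<close>

lemma subset_Cl: "X \<subseteq> Cl X"
proof
  fix x assume "x \<in> X"
  then have "id x \<in> Cl X"
    using miyamoto_group_one unfolding Cl_def by blast
  then show "x \<in> Cl X" by simp
qed

lemma span_Cl_invariant:
  assumes X: "\<forall>x\<in>X. primitive_axis x" and \<rho>: "\<rho> \<in> miyamoto_group X" and v: "v \<in> span (Cl X)"
  shows "\<rho> v \<in> span (Cl X)"
proof -
  interpret l: Vector_Spaces.linear scale scale \<rho>
    using miyamoto_group_automorphism[OF X \<rho>] by (simp add: automorphism_def)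
  have "\<rho> ` Cl X \<subseteq> Cl X"
  proof clarify
    fix y assume "y \<in> Cl X"
    then obtain x \<sigma> where "y = \<sigma> x" "x \<in> X" "\<sigma> \<in> miyamoto_group X"
      by (auto simp: Cl_def)
    then have "(\<rho> \<circ> \<sigma>) x \<in> Cl X"
      using miyamoto_group_comp[OF \<rho>] unfolding Cl_def by blast
    then show "\<rho> y \<in> Cl X"
      using \<open>y = \<sigma> x\<close> by simp
  qed
  then show ?thesis
    using v l.span_image[of "Cl X"] span_mono by blast
qed

lemma span_Cl_subalgebra:
  assumes two: "(2::'f) \<noteq> 0" and X: "\<forall>x\<in>X. primitive_axis x"
  shows "is_subalgebra (span (Cl X))"
proof -
  have X_mult: "x \<bullet> v \<in> span (Cl X)" if "x \<in> X" "v \<in> span (Cl X)" for x v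
    using mult_mem_if_miyamoto_mem(1)[OF two subspace_span _ that(2), of x] X that
      span_Cl_invariant[OF X miyamoto_group_incl] subset_Cl span_base by blast
  have Cl_mult: "a \<bullet> v \<in> span (Cl X)" if "a \<in> Cl X" and v: "v \<in> span (Cl X)" for a v
  proof -
    obtain x \<rho> where a: "a = \<rho> x" "x \<in> X" and \<rho>: "\<rho> \<in> miyamoto_group X"
      using \<open>a \<in> Cl X\<close> by (auto simp: Cl_def)
    obtain \<sigma> where \<sigma>: "\<sigma> \<in> miyamoto_group X" "\<And>y. \<rho> (\<sigma> y) = y"
      using miyamoto_group_inverse[OF X \<rho>] by blast
    \<comment> \<open>Conjugation: \<open>a = \<rho> x\<close> and
      \<open>v = \<rho> (\<sigma> v)\<close>, so the product comes from one with the generator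
      \<open>x\<close>, to which \<open>X_mult\<close> applies.\<close>
    have "a \<bullet> v = \<rho> (x \<bullet> \<sigma> v)"
      using miyamoto_group_automorphism[OF X \<rho>] \<sigma>(2) a(1) by (simp add: automorphism_def)
    then show ?thesis
      using span_Cl_invariant[OF X \<rho>] span_Cl_invariant[OF X \<sigma>(1) v] X_mult a(2) by simp
  qed
  \<comment> \<open>Linearity in the left factor reduces this to left multiplication by elements of
    \<open>Cl X\<close>.\<close>
  have "u \<bullet> v \<in> span (Cl X)" if "u \<in> span (Cl X)" and v: "v \<in> span (Cl X)" for u v
    using that(1)
  proof (induction rule: span_induct_alt)
    case base
    then show ?case by (simp add: span_zero)
  next
    case (step c x y)
    then show ?case
      using Cl_mult v by (simp add: amult_add_left amult_scale_left span_add span_scale)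
  qed
  then show ?thesis by (simp add: is_subalgebra_def)
qed

lemma span_Cl:
  assumes "(2::'f) \<noteq> 0" and "PAJ_generated_by X"
  shows "span (Cl X) = UNIV"
proof -
  have "is_subalgebra hull X \<subseteq> span (Cl X)"
    using span_Cl_subalgebra[OF assms(1), of X] assms(2) subset_Cl[of X] span_superset[of "Cl X"]
    by (intro hull_minimal) (auto simp: PAJ_generated_by_def)
  then show ?thesis
    using assms(2) by (auto simp: PAJ_generated_by_def generated_subalgebra_def)
qed

lemma invariant_subspace_UNIV:
  assumes "(2::'f) \<noteq> 0" and A: "PAJ_generated_by X"
    and V: "subspace V" "X \<subseteq> V" and mem: "\<forall>v\<in>V. \<forall>x\<in>X. x \<bullet> v \<in> V \<or> v \<bullet> x \<in> V"
  shows "V = UNIV"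
proof -
  have X: "\<forall>x\<in>X. primitive_axis x"
    using A by (simp add: PAJ_generated_by_def)
  have "miyamoto x v \<in> V" if "x \<in> X" "v \<in> V" for x v
    using miyamoto_mem_if_mult_mem V X mem that by blast
  then have "Cl X \<subseteq> V"
    using miyamoto_group_subspace_invariant[OF X] V(2) by (auto simp: Cl_def)
  then have "span (Cl X) \<subseteq> V"
    using V(1) by (simp add: span_minimal)
  then show ?thesis
    using span_Cl[OF assms(1) A] by blast
qed

section \<open>Types along orbits of the Miyamoto group\<close>

text \<open>With zero odd part the value of \<open>axis_type\<close> is a mere choice, which
  transport alone could not compare at \<open>x\<close> and \<open>\<rho> x\<close>; there
  \<open>\<rho> x = x\<close> is needed. Otherwise the type is forced, and transport
  decides.\<close>

lemma miyamoto_group_axis_type: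
  assumes X: "\<forall>x\<in>X. primitive_axis x" and x: "primitive_axis x" and \<rho>: "\<rho> \<in> miyamoto_group X"
  shows "primitive_axis (\<rho> x) \<and> axis_type (\<rho> x) = axis_type x"
proof (cases "odd_part x \<subseteq> {0}")
  case True
  have "miyamoto y x = x" if "y \<in> X" for y
    using axis_without_odd_part_even[OF axis_type[OF x] True[unfolded odd_part_def] axis_type]
      miyamoto(2) X that by blast
  then have "\<rho> x = x"
    using miyamoto_group_subspace_invariant[OF X \<rho>, of "{x}" x] by blast
  with x show ?thesis by simp
next
  case False
  have aut: "automorphism \<rho>" by (rule miyamoto_group_automorphism[OF X \<rho>])
  then interpret l: Vector_Spaces.linear scale scale \<rho> by (simp add: automorphism_def)
  have type: "primitive_axis_of_type (axis_type x) (\<rho> x)"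
    by (rule automorphism_axis_of_type[OF aut axis_type[OF x]])
  then have axis: "primitive_axis (\<rho> x)" unfolding primitive_axis_def by blast
  obtain w where w: "w \<in> odd_part x" "w \<noteq> 0"
    using False by blast
  have "inj \<rho>" and mult: "\<rho> u \<bullet> \<rho> v = \<rho> (u \<bullet> v)" for u v
    using aut by (auto simp: automorphism_def bij_is_inj)
  then have "\<rho> w \<noteq> 0"
    using w(2) l.zero by (metis injD)
  \<comment> \<open>The image of \<open>w\<close> is the nonzero odd vector required for uniqueness
    of the type of \<open>\<rho> x\<close>.\<close>
  moreover have "\<rho> w \<in> eigen_part (fst (axis_type x)) (snd (axis_type x)) (\<rho> x)"
    using w(1) by (simp add: odd_part_def eigen_part_def mult l.scale)
  ultimately show ?thesis
    using axis_type_unique[OF type axis_type[OF axis]] axis by blast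
qed

text \<open>An arbitrary set \<open>T\<close> of types treats the three kinds of uniformity at
  once.\<close>

lemma span_primitive_axes:
  assumes "(2::'f) \<noteq> 0" and A: "PAJ_generated_by X" and "uniform T X"
  shows "span (primitive_axes T) = UNIV"
proof -
  have "Cl X \<subseteq> primitive_axes T"
    using miyamoto_group_axis_type[of X] A assms(3)
    by (auto simp: Cl_def uniform_def primitive_axes_def PAJ_generated_by_def)
  then show ?thesis
    using span_mono span_Cl[OF assms(1) A] by blast
qed

end

section \<open>The characteristic, and the conclusion\<close>

lemma two_neq_zero_if_CHAR_neq_two:
  assumes "CHAR('f::field) \<noteq> 2"
  shows "(2::'f) \<noteq> 0"
proof
  assume "(2::'f) = 0"
  then have "CHAR('f) dvd 2"
    using of_nat_eq_0_iff_char_dvd[where ?'a = 'f, of 2] by simp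
  then have "CHAR('f) \<noteq> 0" "CHAR('f) \<le> 2"
    by (metis dvd_0_left zero_neq_numeral, simp add: dvd_imp_le)
  \<comment> \<open>Characteristic 1 would mean \<open>1 = 0\<close> in the field.\<close>
  with assms have "CHAR('f) = 1" by linarith
  then show False by simp
qed

theorem theoremA:
  fixes scale :: "'f::field \<Rightarrow> 'a::ab_group_add \<Rightarrow> 'a"
    and amult :: "'a \<Rightarrow> 'a \<Rightarrow> 'a"
    and axis_type :: "'a \<Rightarrow> 'f \<times> 'f"
    and X :: "'a set"
  assumes "CHAR('f) \<noteq> 2"
    and "typed_algebra scale amult axis_type"
    and "nonassoc_algebra.PAJ_generated_by scale amult X"
  shows "module.span scale (typed_algebra.Cl scale amult axis_type X) = UNIV
    \<and> (\<forall>V. module.subspace scale V \<longrightarrow> X \<subseteq> V \<longrightarrow>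
          (\<forall>v\<in>V. \<forall>x\<in>X. amult x v \<in> V \<or> amult v x \<in> V) \<longrightarrow> V = UNIV)
    \<and> (\<forall>\<mu> \<delta>. typed_algebra.uniform scale amult axis_type {(\<mu>, \<delta>), (\<delta>, \<mu>)} X \<longrightarrow>
          module.span scale (typed_algebra.primitive_axes scale amult axis_type {(\<mu>, \<delta>), (\<delta>, \<mu>)}) = UNIV)
    \<and> (\<forall>\<mu> \<delta>. \<mu> \<noteq> \<delta> \<longrightarrow> typed_algebra.uniform scale amult axis_type {(\<mu>, \<delta>)} X \<longrightarrow>
          module.span scale (typed_algebra.primitive_axes scale amult axis_type {(\<mu>, \<delta>)}) = UNIV)
    \<and> (\<forall>\<mu>. typed_algebra.uniform scale amult axis_type {(\<mu>, \<mu>)} X \<longrightarrow>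
          module.span scale (typed_algebra.primitive_axes scale amult axis_type {(\<mu>, \<mu>)}) = UNIV)"
proof -
  interpret typed_algebra scale amult axis_type by fact
  have "(2::'f) \<noteq> 0"
    using assms(1) by (rule two_neq_zero_if_CHAR_neq_two)
  then show ?thesis
    using span_Cl[OF _ assms(3)] invariant_subspace_UNIV[OF _ assms(3)]
      span_primitive_axes[OF _ assms(3)]
    by blast
qed

end
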